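(* Among nontrivial trees, well-ve-coveredness and well-ve-domination coincide; that is, a nontrivial tree $T$ is well-ve-covered if and only if it is well-ve-dominated.
   Context: All graphs are finite, simple and undirected. A tree is nontrivial if it has at least two vertices. A vertex $v$ ve-dominates an edge $e$ if at least one endpoint of $e$ belongs to the closed neighborhood $N_G[v]$. A set $D\subseteq V(G)$ is a ve-dominating set if every edge of $G$ is ve-dominated by some vertex of $D$; it is minimal if no proper subset is ve-dominating, and independent if its vertices are pairwise nonadjacent. $G$ is well-ve-dominated if all its minimal ve-dominating sets have the same cardinality. $G$ is well-ve-covered if all its minimal independent ve-dominating sets have the same cardinality. *)

theory Defs
  imports "Graph_Theory.Graph_Theory"
begin

text \<open>
  A finite simple undirected graph is a digraph satisfying \<open>pair_graph\<close> (finite, loop-free,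
  symmetric, arcs being pairs of vertices). An undirected edge \<open>uv\<close> is represented by the two arcs
  \<open>(u, v)\<close> and \<open>(v, u)\<close>; the predicates on edges below do not depend on the orientation.
\<close>

text \<open>
  The predicates \<open>forest\<close> and \<open>tree\<close> of \<open>Digraph_Component\<close> are not suitable here: every edge of a
  symmetric digraph gives a directed cycle \<open>u, v, u\<close> of length two. The cycles of a simple undirected
  graph are exactly the directed cycles of length at least three.
\<close>

definition undirected_tree :: "'a pair_pre_digraph \<Rightarrow> bool" where
  "undirected_tree G \<longleftrightarrow>
    pair_graph G \<and> connected (with_proj G) \<and>
    \<not> (\<exists>p. pre_digraph.cycle (with_proj G) p \<and> 3 \<le> length p)"

definition closed_nbhd :: "'a pair_pre_digraph \<Rightarrow> 'a \<Rightarrow> 'a set" where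
  "closed_nbhd G v = {v} \<union> {u \<in> pverts G. (v, u) \<in> parcs G}"

definition ve_dominates :: "'a pair_pre_digraph \<Rightarrow> 'a \<Rightarrow> 'a \<times> 'a \<Rightarrow> bool" where
  "ve_dominates G v e \<longleftrightarrow> fst e \<in> closed_nbhd G v \<or> snd e \<in> closed_nbhd G v"

definition ve_dominating_set :: "'a pair_pre_digraph \<Rightarrow> 'a set \<Rightarrow> bool" where
  "ve_dominating_set G D \<longleftrightarrow>
    D \<subseteq> pverts G \<and> (\<forall>e \<in> parcs G. \<exists>v \<in> D. ve_dominates G v e)"

definition minimal_ve_dominating_set :: "'a pair_pre_digraph \<Rightarrow> 'a set \<Rightarrow> bool" where
  "minimal_ve_dominating_set G D \<longleftrightarrow>
    ve_dominating_set G D \<and> (\<forall>D'. D' \<subset> D \<longrightarrow> \<not> ve_dominating_set G D')"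

definition independent_set :: "'a pair_pre_digraph \<Rightarrow> 'a set \<Rightarrow> bool" where
  "independent_set G D \<longleftrightarrow> D \<subseteq> pverts G \<and> (\<forall>u \<in> D. \<forall>v \<in> D. (u, v) \<notin> parcs G)"

definition well_ve_dominated :: "'a pair_pre_digraph \<Rightarrow> bool" where
  "well_ve_dominated G \<longleftrightarrow>
    (\<forall>D D'. minimal_ve_dominating_set G D \<and> minimal_ve_dominating_set G D' \<longrightarrow> card D = card D')"

text \<open>
  Subsets of independent sets are independent, so an independent minimal ve-dominating set is the
  same as a minimal element among the independent ve-dominating sets.
\<close>

definition well_ve_covered :: "'a pair_pre_digraph \<Rightarrow> bool" where
  "well_ve_covered G \<longleftrightarrow>
    (\<forall>D D'. minimal_ve_dominating_set G D \<and> independent_set G D \<and>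
            minimal_ve_dominating_set G D' \<and> independent_set G D' \<longrightarrow> card D = card D')"

end

theory Submission
  imports Defs
begin

text \<open>
  The non-trivial direction rests on a structure theorem: a well-ve-covered forest has a \<^emph>\<open>star
  partition\<close>. This is a set \<open>B\<close> of vertices whose closed neighbourhoods are disjoint and together
  contain all non-isolated vertices, where every \<open>b \<in> B\<close> has a leaf neighbour and at most one
  neighbour that is not a leaf. A star is one such neighbourhood; the other trees of this kind arise
  from a tree by attaching the centre of a new non-trivial star to each of its vertices.

  A star partition forces all minimal ve-dominating sets, independent or not, to have \<open>card B\<close>
  elements (\<open>star_partition_card\<close>). The edge from \<open>b\<close> to a leaf is dominated exactly by the vertices
  of \<open>N[b]\<close>, so a ve-dominating set meets every \<open>N[b]\<close>. Within \<open>N[b]\<close> the sets of dominated edges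
  form a chain: a leaf dominates no more than \<open>b\<close>, and \<open>b\<close> no more than its non-leaf neighbour. Two
  members of a minimal set cannot be comparable in this way, so it meets \<open>N[b]\<close> just once.

  The structure theorem (\<open>well_covered_forest_star_partition\<close>) is proved by induction on the number
  of edges. Some vertex \<open>b\<close> has a leaf neighbour \<open>l\<close> and at most one non-leaf neighbour \<open>v\<close>. Deleting
  \<open>N[b]\<close> leaves a well-ve-covered forest, because adding \<open>b\<close> turns its independent minimal sets into
  such sets of the whole forest. By induction the rest has a star partition \<open>B\<close>, so the independent minimal
  sets of the whole forest all have \<open>card B + 1\<close> elements. Then \<open>insert b B\<close> is a star partition, since
  every way in which the edges at \<open>v\<close> could spoil this yields an independent minimal set of a wrong
  size. Sets that are too small replace a centre in \<open>B\<close> by \<open>v\<close> (\<open>v_nbr_not_centre\<close>,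
  \<open>v_nbr_class_not_pair\<close>); sets that are too large contain \<open>l\<close> and a neighbour of \<open>v\<close>
  (\<open>v_nbr_not_leaf\<close>, \<open>v_nbr_leaf_class_all_leaves\<close>).
\<close>

section \<open>Edge relations of graphs\<close>

definition sgraph :: "'a rel \<Rightarrow> bool" where
  "sgraph E \<longleftrightarrow> finite E \<and> sym E \<and> irrefl E"

text \<open>
  A finite graph is a forest iff each of its non-empty induced subgraphs has a vertex of degree at most
  one. This form passes to subgraphs at once, and applied to the set of non-leaves it yields the
  vertex that starts the induction.
\<close>

definition acyclic_graph :: "'a rel \<Rightarrow> bool" where
  "acyclic_graph E \<longleftrightarrow>
    (\<forall>S. finite S \<longrightarrow> S \<noteq> {} \<longrightarrow>
      (\<exists>s\<in>S. \<forall>x\<in>S. \<forall>y\<in>S. (s, x) \<in> E \<longrightarrow> (s, y) \<in> E \<longrightarrow> x = y))"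

definition clnb :: "'a rel \<Rightarrow> 'a \<Rightarrow> 'a set" where
  "clnb E v = insert v (E `` {v})"

definition leaf :: "'a rel \<Rightarrow> 'a \<Rightarrow> bool" where
  "leaf E x \<longleftrightarrow> (\<exists>y. E `` {x} = {y})"

definition dominators :: "'a rel \<Rightarrow> 'a \<times> 'a \<Rightarrow> 'a set" where
  "dominators E e = clnb E (fst e) \<union> clnb E (snd e)"

definition ve_dom :: "'a rel \<Rightarrow> 'a set \<Rightarrow> bool" where
  "ve_dom E D \<longleftrightarrow> (\<forall>e\<in>E. D \<inter> dominators E e \<noteq> {})"

text \<open>
  Minimality is expressed by private edges: every member is the only one that dominates some edge
  (see \<open>min_ve_dom_iff_minimal\<close>). This avoids the quantification over proper subsets.
\<close>

definition min_ve_dom :: "'a rel \<Rightarrow> 'a set \<Rightarrow> bool" where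
  "min_ve_dom E D \<longleftrightarrow> ve_dom E D \<and> (\<forall>d\<in>D. \<exists>e\<in>E. D \<inter> dominators E e = {d})"

definition indep :: "'a rel \<Rightarrow> 'a set \<Rightarrow> bool" where
  "indep E D \<longleftrightarrow> (\<forall>x\<in>D. \<forall>y\<in>D. (x, y) \<notin> E)"

definition star_partition :: "'a rel \<Rightarrow> 'a set \<Rightarrow> bool" where
  "star_partition E B \<longleftrightarrow>
    (\<forall>b\<in>B. \<exists>l. (b, l) \<in> E \<and> leaf E l) \<and>
    (\<forall>b\<in>B. \<forall>x y. (b, x) \<in> E \<longrightarrow> (b, y) \<in> E \<longrightarrow> \<not> leaf E x \<longrightarrow> \<not> leaf E y \<longrightarrow> x = y) \<and>
    (\<forall>b\<in>B. \<forall>c\<in>B. b \<noteq> c \<longrightarrow> clnb E b \<inter> clnb E c = {}) \<and>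
    Field E \<subseteq> (\<Union>b\<in>B. clnb E b)"

lemma sgraph_sym: "sgraph E \<Longrightarrow> (x, y) \<in> E \<Longrightarrow> (y, x) \<in> E"
  by (auto simp: sgraph_def dest: symD)

lemma sgraph_sym_iff: "sgraph E \<Longrightarrow> (x, y) \<in> E \<longleftrightarrow> (y, x) \<in> E"
  using sgraph_sym by metis

lemma sgraph_irrefl: "sgraph E \<Longrightarrow> (x, x) \<notin> E"
  by (auto simp: sgraph_def irrefl_def)

lemma mem_clnb: "u \<in> clnb E v \<longleftrightarrow> u = v \<or> (v, u) \<in> E"
  by (auto simp: clnb_def)

lemma leaf_unique: "leaf E l \<Longrightarrow> (l, y) \<in> E \<Longrightarrow> (l, z) \<in> E \<Longrightarrow> y = z"
  by (metis Image_singleton_iff leaf_def singletonD)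

lemma leafI: "(l, y) \<in> E \<Longrightarrow> (\<And>z. (l, z) \<in> E \<Longrightarrow> z = y) \<Longrightarrow> leaf E l"
  by (auto simp: leaf_def)

lemma not_leaf_other_nbr:
  assumes "\<not> leaf E x" "(x, y) \<in> E"
  obtains z where "(x, z) \<in> E" "z \<noteq> y"
  using assms leafI by metis

lemma acyclic_graph_no_cycle:
  assumes "acyclic_graph E" "finite S" "S \<noteq> {}"
    and "\<And>s. s \<in> S \<Longrightarrow> \<exists>x\<in>S. \<exists>y\<in>S. x \<noteq> y \<and> (s, x) \<in> E \<and> (s, y) \<in> E"
  shows False
  using assms unfolding acyclic_graph_def by metis

text \<open>
  The vertices of a cycle have two neighbours each on the cycle. The list form reduces the exclusion
  of a concrete short cycle to a list of its edges.
\<close>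

lemma acyclic_graph_no_cyclic_list:
  assumes "sgraph E" "acyclic_graph E" and d: "distinct p" and len: "3 \<le> length p"
    and p: "successively (\<lambda>x y. (x, y) \<in> E) p" and cl: "(last p, hd p) \<in> E"
  shows False
proof (rule acyclic_graph_no_cycle[OF assms(2), of "set p"])
  show "set p \<noteq> {}" using len by auto
  fix s assume "s \<in> set p"
  then obtain xs ys where s: "p = xs @ s # ys" by (auto dest: split_list)
  let ?x = "if xs = [] then last p else last xs" and ?y = "if ys = [] then hd p else hd ys"
  have "(s, ?x) \<in> E"
    using s p cl sgraph_sym_iff[OF assms(1)]
    by (auto simp: successively_append_iff successively_Cons)
  moreover have "(s, ?y) \<in> E"
    using s p cl by (auto simp: successively_append_iff successively_Cons)
  moreover have "?x \<noteq> ?y"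
  proof (cases xs; cases ys)
    assume "xs = []" "ys = []" then show ?thesis using len s by simp
  next
    fix b ys' assume "xs = []" "ys = b # ys'"
    then show ?thesis using len s d by (cases ys') auto
  next
    fix a xs' assume "xs = a # xs'" "ys = []"
    then have p: "p = a # xs' @ [s]" "xs' \<noteq> []" using len s by auto
    then have "last xs' \<in> set xs'" "a \<notin> set xs'" using d by auto
    then have "a \<noteq> last xs'" by metis
    then show ?thesis using p \<open>xs = a # xs'\<close> \<open>ys = []\<close> by simp
  next
    fix a xs' b ys' assume "xs = a # xs'" "ys = b # ys'"
    then have "last xs \<in> set xs" "hd ys \<in> set ys" "xs \<noteq> []" "ys \<noteq> []" by auto
    then show ?thesis using s d by (auto simp del: last_in_set hd_in_set)
  qed
  moreover have "?x \<in> set p" "?y \<in> set p" using s by (cases xs; cases ys; auto)+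
  ultimately show "\<exists>x\<in>set p. \<exists>y\<in>set p. x \<noteq> y \<and> (s, x) \<in> E \<and> (s, y) \<in> E" by blast
qed simp

lemma acyclic_graph_subset: "acyclic_graph E \<Longrightarrow> F \<subseteq> E \<Longrightarrow> acyclic_graph F"
  unfolding acyclic_graph_def by (meson subsetD)

text \<open>
  This is why classes of the form \<open>N[b]\<close> matter: an edge to a leaf obliges every ve-dominating set to
  meet \<open>N[b]\<close>, and serves as private edge of whichever vertex of \<open>N[b]\<close> is taken.
\<close>

lemma dominators_leaf_edge:
  assumes "sgraph E" "(b, l) \<in> E" "leaf E l"
  shows "dominators E (b, l) = clnb E b"
  using assms leaf_unique[of E l] sgraph_sym_iff[of E b l]
  by (auto simp: dominators_def clnb_def)

lemma ve_domI:
  assumes "\<And>x y. (x, y) \<in> E \<Longrightarrow> \<exists>d\<in>D. d \<in> clnb E x \<or> d \<in> clnb E y"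
  shows "ve_dom E D"
  using assms by (fastforce simp: ve_dom_def dominators_def)

lemma indep_insertI:
  assumes "sgraph E" "indep E D" "\<And>u. u \<in> D \<Longrightarrow> (x, u) \<notin> E"
  shows "indep E (insert x D)"
  using assms(2,3) sgraph_sym[OF assms(1)] sgraph_irrefl[OF assms(1)]
  unfolding indep_def by blast

lemma private_edgeI:
  assumes "(x, y) \<in> E" "d \<in> D" "d \<in> clnb E x \<or> d \<in> clnb E y"
    and "\<And>u. u \<in> D \<Longrightarrow> u \<in> clnb E x \<or> u \<in> clnb E y \<Longrightarrow> u = d"
  shows "\<exists>e\<in>E. D \<inter> dominators E e = {d}"
proof
  show "D \<inter> dominators E (x, y) = {d}"
    unfolding dominators_def fst_conv snd_conv using assms(2-) by blast
qed (rule assms(1))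

lemma min_ve_dom_subset_Field:
  assumes "min_ve_dom E D" shows "D \<subseteq> Field E"
proof
  fix d assume "d \<in> D"
  then obtain e where e: "e \<in> E" "D \<inter> dominators E e = {d}"
    using assms by (auto simp: min_ve_dom_def)
  then have "d \<in> dominators E e" by blast
  with e(1) show "d \<in> Field E"
    by (cases e) (auto simp: dominators_def clnb_def Field_def)
qed

lemma min_ve_dom_iff_minimal:
  "min_ve_dom E D \<longleftrightarrow> ve_dom E D \<and> (\<forall>D'. D' \<subset> D \<longrightarrow> \<not> ve_dom E D')"
proof
  assume m: "min_ve_dom E D"
  have "\<not> ve_dom E D'" if "D' \<subset> D" for D'
  proof -
    obtain d where d: "d \<in> D" "d \<notin> D'" using \<open>D' \<subset> D\<close> by blast
    then obtain e where e: "e \<in> E" "D \<inter> dominators E e = {d}"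
      using m by (auto simp: min_ve_dom_def)
    have "D' \<inter> dominators E e \<subseteq> D \<inter> dominators E e" using that by blast
    then have "D' \<inter> dominators E e = {}"
      unfolding e(2) using d(2) by (metis IntD1 insertI1 subset_singletonD)
    with e(1) show ?thesis by (auto simp: ve_dom_def)
  qed
  with m show "ve_dom E D \<and> (\<forall>D'. D' \<subset> D \<longrightarrow> \<not> ve_dom E D')"
    by (auto simp: min_ve_dom_def)
next
  assume r: "ve_dom E D \<and> (\<forall>D'. D' \<subset> D \<longrightarrow> \<not> ve_dom E D')"
  have "\<exists>e\<in>E. D \<inter> dominators E e = {d}" if d: "d \<in> D" for d
  proof -
    have "\<not> ve_dom E (D - {d})" using r d by blast
    then obtain e where "e \<in> E" "(D - {d}) \<inter> dominators E e = {}"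
      by (auto simp: ve_dom_def)
    moreover from this r have "D \<inter> dominators E e \<noteq> {}" by (auto simp: ve_dom_def)
    ultimately show ?thesis by blast
  qed
  with r show "min_ve_dom E D" by (auto simp: min_ve_dom_def)
qed

lemma ve_dom_contains_minimal:
  assumes "finite D" "ve_dom E D"
  obtains D' where "D' \<subseteq> D" "min_ve_dom E D'"
proof -
  have "\<exists>D'\<subseteq>D. min_ve_dom E D'"
    using assms
  proof (induction D rule: finite_psubset_induct)
    case (psubset D)
    show ?case
    proof (cases "\<exists>D'. D' \<subset> D \<and> ve_dom E D'")
      case True
      with psubset.IH show ?thesis by (meson psubset_imp_subset subset_trans)
    next
      case False
      with psubset.prems show ?thesis by (auto simp: min_ve_dom_iff_minimal)
    qed
  qed
  then show thesis using that by blast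
qed

section \<open>Star partitions\<close>

lemma star_partition_unique:
  assumes "star_partition E B" "b \<in> B" "c \<in> B" "x \<in> clnb E b" "x \<in> clnb E c"
  shows "b = c"
  using assms unfolding star_partition_def by blast

text \<open>
  In \<open>N[b]\<close>, all edges that a leaf dominates contain \<open>b\<close>, hence are dominated by every vertex of
  \<open>N[b]\<close>. All edges that \<open>b\<close> dominates contain \<open>b\<close> or the only non-leaf neighbour of \<open>b\<close>, hence are
  dominated by that neighbour.
\<close>

lemma star_partition_domination_nested:
  assumes G: "sgraph E" and P: "star_partition E B" and b: "b \<in> B"
    and d: "d \<in> clnb E b" "d' \<in> clnb E b"
  shows "(\<forall>e\<in>E. d \<in> dominators E e \<longrightarrow> d' \<in> dominators E e) \<or>
         (\<forall>e\<in>E. d' \<in> dominators E e \<longrightarrow> d \<in> dominators E e)"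
proof -
  have leaf_below: "t \<in> dominators E e"
    if "leaf E s" "(b, s) \<in> E" "t \<in> clnb E b" "e \<in> E" "s \<in> dominators E e" for s t e
  proof -
    obtain x y where e: "e = (x, y)" by fastforce
    have "x = b \<or> y = b"
      using that e leaf_unique[of E s] sgraph_sym_iff[OF G]
      by (auto simp: dominators_def mem_clnb)
    with that(3) e show ?thesis by (auto simp: dominators_def)
  qed
  have centre_below: "t \<in> dominators E e"
    if t: "\<not> leaf E t" "(b, t) \<in> E" and e: "e \<in> E" "b \<in> dominators E e" for t e
  proof -
    obtain x y where xy: "e = (x, y)" by fastforce
    have one: "t \<in> clnb E x \<or> y = b" if "(x, y) \<in> E" "b \<in> clnb E x" for x y
    proof (cases "x = b")
      case True then show ?thesis using t by (simp add: mem_clnb)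
    next
      case False
      then have bx: "(b, x) \<in> E" using that sgraph_sym_iff[OF G] by (auto simp: mem_clnb)
      show ?thesis
      proof (cases "leaf E x")
        case True
        then show ?thesis using leaf_unique[of E x] bx that(1) sgraph_sym[OF G] by metis
      next
        case False
        then have "x = t" using P b bx t by (auto simp: star_partition_def)
        then show ?thesis by (simp add: mem_clnb)
      qed
    qed
    show ?thesis
      using one[of x y] one[of y x] e t sgraph_sym_iff[OF G, of x y]
      by (auto simp: xy dominators_def mem_clnb)
  qed
  consider "(b, d) \<in> E" "leaf E d" | "(b, d') \<in> E" "leaf E d'"
    | "d = d'" | "d = b" "(b, d') \<in> E" "\<not> leaf E d'" | "d' = b" "(b, d) \<in> E" "\<not> leaf E d"
    using d P b by (auto simp: mem_clnb star_partition_def)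
  then show ?thesis
    using leaf_below centre_below d by cases blast+
qed

text \<open>
  A minimal set meets every class, and only once: by nestedness, of two members of the same class one
  could not have a private edge.
\<close>

lemma star_partition_card:
  assumes G: "sgraph E" and P: "star_partition E B" and D: "min_ve_dom E D"
  shows "card D = card B"
proof -
  have DF: "D \<subseteq> Field E" using D by (rule min_ve_dom_subset_Field)
  have finF: "finite (Field E)" using G by (simp add: sgraph_def finite_Field)
  have "B \<subseteq> Field E" using P by (auto simp: star_partition_def Field_def)
  then have finB: "finite B" and finD: "finite D" using DF finF finite_subset by auto
  have one: "card (D \<inter> clnb E b) = 1" if b: "b \<in> B" for b
  proof -
    obtain l where l: "(b, l) \<in> E" "leaf E l" using P b by (auto simp: star_partition_def)
    then have ne: "D \<inter> clnb E b \<noteq> {}"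
      using D dominators_leaf_edge[OF G l] unfolding min_ve_dom_def ve_dom_def by metis
    have "d = d'" if dd: "d \<in> D \<inter> clnb E b" "d' \<in> D \<inter> clnb E b" for d d'
    proof -
      have priv: "\<exists>e\<in>E. s \<in> dominators E e \<and> t \<notin> dominators E e"
        if "s \<in> D" "t \<in> D" "s \<noteq> t" for s t
      proof -
        obtain e where e: "e \<in> E" "D \<inter> dominators E e = {s}"
          using D \<open>s \<in> D\<close> by (auto simp: min_ve_dom_def)
        then have "s \<in> D \<inter> dominators E e" "t \<notin> D \<inter> dominators E e" using that by auto
        with e(1) that show ?thesis by auto
      qed
      show ?thesis
        using star_partition_domination_nested[OF G P b, of d d'] dd priv by blast
    qed
    with ne have "\<exists>d. D \<inter> clnb E b = {d}" by blast
    then show ?thesis by auto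
  qed
  have "D = (\<Union>b\<in>B. D \<inter> clnb E b)" using DF P by (auto simp: star_partition_def)
  then have "card D = card (\<Union>b\<in>B. D \<inter> clnb E b)" by simp
  also have "\<dots> = (\<Sum>b\<in>B. card (D \<inter> clnb E b))"
    using finB finD by (intro card_UN_disjoint) (auto dest: star_partition_unique[OF P])
  also have "\<dots> = card B" using one by simp
  finally show ?thesis .
qed

lemma star_partition_centres:
  assumes G: "sgraph E" and P: "star_partition E B"
  shows "min_ve_dom E B" "indep E B"
proof -
  have disj: "c = b" if "b \<in> B" "c \<in> B" "c \<in> clnb E b" for b c
    using star_partition_unique[OF P that(1,2,3)] by (simp add: mem_clnb)
  show "indep E B"
    using disj sgraph_irrefl[OF G] unfolding indep_def mem_clnb by metis
  have "ve_dom E B"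
  proof (rule ve_domI)
    fix x y assume "(x, y) \<in> E"
    then have "x \<in> Field E" by (auto simp: Field_def)
    then obtain c where "c \<in> B" "x \<in> clnb E c" using P by (auto simp: star_partition_def)
    then show "\<exists>d\<in>B. d \<in> clnb E x \<or> d \<in> clnb E y"
      using sgraph_sym_iff[OF G] by (auto simp: mem_clnb)
  qed
  moreover have "\<exists>e\<in>E. B \<inter> dominators E e = {b}" if b: "b \<in> B" for b
  proof -
    obtain l where l: "(b, l) \<in> E" "leaf E l" using P b by (auto simp: star_partition_def)
    have "b \<in> clnb E b" by (simp add: mem_clnb)
    then have "B \<inter> clnb E b = {b}" using disj[OF b] b by blast
    then have "B \<inter> dominators E (b, l) = {b}" by (simp only: dominators_leaf_edge[OF G l])
    with l(1) show ?thesis by blast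
  qed
  ultimately show "min_ve_dom E B" by (simp add: min_ve_dom_def)
qed

section \<open>Cutting off an end star\<close>

text \<open>
  Here \<open>b\<close> has the leaf neighbour \<open>l\<close>, and \<open>v\<close> is the only neighbour of \<open>b\<close> that may fail to be a
  leaf. The case of a component that is a star is included: then \<open>v\<close> is a leaf as well, possibly
  \<open>l\<close> itself.
\<close>

locale end_star =
  fixes E :: "'a rel" and b l v :: 'a
  assumes G: "sgraph E" and ac: "acyclic_graph E"
    and bl: "(b, l) \<in> E" and leaf_l: "leaf E l"
    and bv: "(b, v) \<in> E"
    and others: "\<And>x. (b, x) \<in> E \<Longrightarrow> x \<noteq> v \<Longrightarrow> leaf E x"
begin

definition rest :: "'a rel" where
  "rest = E \<inter> (- clnb E b) \<times> (- clnb E b)"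

lemmas sym_iff = sgraph_sym_iff[OF G]
lemmas symE = sgraph_sym[OF G]
lemmas irr = sgraph_irrefl[OF G]

lemma rest_subset: "rest \<subseteq> E" by (auto simp: rest_def)

lemma sgraph_rest: "sgraph rest"
  using G finite_subset[OF rest_subset]
  by (auto simp: sgraph_def rest_def sym_def irrefl_def)

lemma restD:
  assumes "(x, y) \<in> rest"
  shows "(x, y) \<in> E" "(y, x) \<in> rest" "x \<notin> clnb E b" "y \<notin> clnb E b"
  using assms sgraph_sym_iff[OF sgraph_rest] by (auto simp: rest_def)

text \<open>The star at \<open>b\<close> is attached to the remaining graph through \<open>v\<close> only.\<close>

lemma outside_nbr:
  assumes "x \<notin> clnb E b" "(x, y) \<in> E"
  shows "(x, y) \<in> rest \<or> y = v"
proof (cases "y \<in> clnb E b")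
  case True
  have "y \<noteq> b" using assms sym_iff by (auto simp: mem_clnb)
  with True have "(b, y) \<in> E" by (simp add: mem_clnb)
  moreover have "\<not> leaf E y"
    using leaf_unique[of E y x b] assms sym_iff \<open>(b, y) \<in> E\<close> by (auto simp: mem_clnb)
  ultimately show ?thesis using others by blast
next
  case False with assms show ?thesis by (simp add: rest_def)
qed

lemma edge_cases:
  assumes "(x, y) \<in> E"
  obtains "(x, y) \<in> rest" | "x = b" | "y = b" | "x = v" | "y = v"
proof -
  consider "x \<notin> clnb E b" | "y \<notin> clnb E b" | "x \<in> clnb E b" "y \<in> clnb E b" by blast
  then show thesis
  proof cases
    case 1 then show thesis using outside_nbr assms that by blast
  next
    case 2
    then show thesis using outside_nbr[of y x] assms symE that restD(2) by blast
  next
    case 3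
    then show thesis
      using assms that others leaf_unique[of E x y b] sym_iff by (auto simp: mem_clnb)
  qed
qed

lemma rest_Field: "x \<in> Field rest \<Longrightarrow> x \<notin> clnb E b"
  by (auto simp: rest_def Field_def)

lemma dominators_rest:
  assumes "D \<subseteq> Field rest" "e \<in> rest"
  shows "D \<inter> dominators E e = D \<inter> dominators rest e"
proof -
  have "D \<inter> clnb E x = D \<inter> clnb rest x" if "x \<notin> clnb E b" for x
    using assms(1) rest_Field that by (auto simp: clnb_def rest_def)
  then show ?thesis using assms(2)
    by (cases e) (auto simp: dominators_def dest: restD)
qed

lemma indep_rest: 
  assumes "D \<subseteq> Field rest" "indep rest D" shows "indep E D"
  using assms rest_Field unfolding indep_def rest_def by blast

text \<open>
  The vertex \<open>b\<close> dominates all edges that are not in \<open>rest\<close> and none that is, and its private edge is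
  the one to \<open>l\<close>. Hence well-ve-coveredness passes from \<open>E\<close> to \<open>rest\<close>, and the common size drops by
  one.
\<close>

lemma min_ve_dom_insert_centre:
  assumes "min_ve_dom rest D" "indep rest D"
  shows "min_ve_dom E (insert b D)" "indep E (insert b D)" "b \<notin> D"
proof -
  have F: "D \<subseteq> Field rest" using assms(1) by (rule min_ve_dom_subset_Field)
  then have out: "\<And>d. d \<in> D \<Longrightarrow> d \<notin> clnb E b" using rest_Field by blast
  then show "b \<notin> D" by (auto simp: clnb_def)
  show "indep E (insert b D)"
    using indep_rest[OF F assms(2)] out irr symE
    unfolding indep_def mem_clnb by blast
  have "ve_dom E (insert b D)"
  proof (rule ve_domI)
    fix x y assume "(x, y) \<in> E"
    then show "\<exists>d\<in>insert b D. d \<in> clnb E x \<or> d \<in> clnb E y"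
    proof (cases rule: edge_cases)
      case 1
      then have "D \<inter> dominators E (x, y) \<noteq> {}"
        using assms(1) dominators_rest[OF F 1] by (auto simp: min_ve_dom_def ve_dom_def)
      then show ?thesis by (auto simp: dominators_def)
    qed (use bv sym_iff in \<open>auto simp: mem_clnb\<close>)
  qed
  moreover have "\<exists>e\<in>E. insert b D \<inter> dominators E e = {d}" if d: "d \<in> insert b D" for d
  proof (cases "d = b")
    case True
    have "insert b D \<inter> clnb E b = {b}" using out by (auto simp: mem_clnb)
    with True bl dominators_leaf_edge[OF G bl leaf_l] show ?thesis by auto
  next
    case False
    with d obtain e where e: "e \<in> rest" "D \<inter> dominators rest e = {d}"
      using assms(1) by (auto simp: min_ve_dom_def)
    then have "D \<inter> dominators E e = {d}" using dominators_rest[OF F] by simp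
    moreover have "b \<notin> dominators E e"
      using e(1) sym_iff by (cases e) (auto simp: rest_def dominators_def mem_clnb)
    ultimately show ?thesis using e(1) rest_subset by auto
  qed
  ultimately show "min_ve_dom E (insert b D)" by (simp add: min_ve_dom_def)
qed

end

text \<open>
  The situation of the induction step: the remaining graph has a star partition, whose set of centres
  together with \<open>b\<close> fixes the common size of the independent minimal sets.
\<close>

locale end_star_covered = end_star +
  fixes B :: "'a set"
  assumes P: "star_partition rest B"
    and size: "\<And>D. min_ve_dom E D \<Longrightarrow> indep E D \<Longrightarrow> card D = Suc (card B)"
begin

lemma B_Field: "B \<subseteq> Field rest"
  using P by (auto simp: star_partition_def Field_def)

lemma B_outside: "c \<in> B \<Longrightarrow> c \<notin> clnb E b"
  using B_Field rest_Field by blast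

lemma v_notin_B: "v \<notin> B"
  using B_outside bv by (auto simp: mem_clnb)

lemma finite_B: "finite B"
  using B_Field sgraph_rest finite_Field finite_subset unfolding sgraph_def by metis

lemma indep_B: "indep E B"
  using star_partition_centres[OF sgraph_rest P] indep_rest B_Field by blast

lemma class_unique:
  assumes "c \<in> B" "c' \<in> B" "x \<in> clnb rest c" "x \<in> clnb rest c'"
  shows "c = c'"
  using star_partition_unique[OF P] assms by blast

lemma class_ex:
  assumes "x \<in> Field rest" obtains c where "c \<in> B" "x \<in> clnb rest c"
  using P assms unfolding star_partition_def by blast

lemma nonleaf_unique:
  assumes "c \<in> B" "(c, x) \<in> rest" "(c, y) \<in> rest" "\<not> leaf rest x" "\<not> leaf rest y"
  shows "x = y"
  using P assms unfolding star_partition_def by blast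

text \<open>An independent ve-dominating set contains a minimal one, which has the common size.\<close>

lemma size_lower:
  assumes "finite D" "ve_dom E D" "indep E D"
  shows "Suc (card B) \<le> card D"
proof -
  obtain D' where "D' \<subseteq> D" "min_ve_dom E D'"
    using ve_dom_contains_minimal assms by metis
  moreover from this assms have "indep E D'" by (auto simp: indep_def)
  ultimately show ?thesis using size card_mono[OF assms(1)] by metis
qed

text \<open>
  If \<open>v\<close> replaces the centres in a non-empty set \<open>C\<close> that includes all centres adjacent to \<open>v\<close>, the
  result is independent but too small to be ve-dominating. It dominates all edges outside \<open>rest\<close>, so
  it misses an edge inside a part of \<open>rest\<close> that only centres in \<open>C\<close> take care of.
\<close>

lemma not_dominated_by_v:
  assumes "C \<subseteq> B" "c \<in> C" and nv: "\<And>c. c \<in> B - C \<Longrightarrow> (v, c) \<notin> E"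
  obtains x y where "(x, y) \<in> rest" "(v, x) \<notin> E" "(v, y) \<notin> E"
    "\<And>c. c \<in> B \<Longrightarrow> x \<in> clnb rest c \<or> y \<in> clnb rest c \<Longrightarrow> c \<in> C"
proof -
  let ?D = "insert v (B - C)"
  have "card ?D \<le> card B"
  proof -
    have "card (B - C) < card B"
      using assms finite_B by (intro psubset_card_mono) auto
    then show ?thesis using finite_B by (simp add: card_insert_if)
  qed
  moreover have "indep E ?D"
    using indep_B nv symE irr unfolding indep_def by blast
  ultimately have "\<not> ve_dom E ?D" using size_lower[of ?D] finite_B by auto
  then obtain x y where xy: "(x, y) \<in> E" "?D \<inter> dominators E (x, y) = {}"
    by (auto simp: ve_dom_def)
  then have nd: "d \<notin> clnb E x" "d \<notin> clnb E y" if "d \<in> ?D" for d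
    using that by (auto simp: dominators_def)
  have v: "x \<noteq> v" "y \<noteq> v" "(v, x) \<notin> E" "(v, y) \<notin> E" 
    using nd[of v] sym_iff by (auto simp: mem_clnb)
  then have "(x, y) \<in> rest"
    using edge_cases[OF xy(1)] xy(1) nd[of v] bv symE by (metis insertI1 mem_clnb)
  moreover have "c \<in> C" if "c \<in> B" "x \<in> clnb rest c \<or> y \<in> clnb rest c" for c
  proof (rule ccontr)
    assume "c \<notin> C"
    then have "c \<in> ?D" using that by simp
    then show False using nd[of c] that(2) rest_subset sym_iff by (auto simp: mem_clnb)
  qed
  ultimately show thesis using that v by blast
qed

text \<open>
  If \<open>v\<close> replaces all centres adjacent to it, the missed edge \<open>xy\<close> joins neighbours of such centres
  \<open>c\<close> and \<open>c'\<close>. If \<open>c = c'\<close>, this centre has the two non-leaf neighbours \<open>x\<close> and \<open>y\<close>; otherwise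
  there is a cycle \<open>v, c, x, y, c'\<close>.
\<close>

lemma v_nbr_not_centre:
  assumes "(v, w) \<in> E" shows "w \<notin> B"
proof
  assume w: "w \<in> B"
  define C where "C = {c \<in> B. (v, c) \<in> E}"
  obtain x y where xy: "(x, y) \<in> rest" "(v, x) \<notin> E" "(v, y) \<notin> E"
    and cl: "\<And>c. c \<in> B \<Longrightarrow> x \<in> clnb rest c \<or> y \<in> clnb rest c \<Longrightarrow> c \<in> C"
  proof (rule not_dominated_by_v[of C w])
    show "C \<subseteq> B" "w \<in> C" using w assms by (auto simp: C_def)
    show "(v, c) \<notin> E" if "c \<in> B - C" for c using that by (simp add: C_def)
  qed blast
  obtain c where c: "c \<in> B" "x \<in> clnb rest c" using class_ex[of x] xy(1) by (auto simp: Field_def)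
  obtain c' where c': "c' \<in> B" "y \<in> clnb rest c'"
    using class_ex[of y] xy(1) by (auto simp: Field_def)
  have vc: "(v, c) \<in> E" "(v, c') \<in> E" using cl[of c] cl[of c'] c c' by (auto simp: C_def)
  then have cx: "(c, x) \<in> rest" "(c', y) \<in> rest" using c c' xy by (auto simp: mem_clnb)
  have xy': "x \<noteq> y" using xy(1) restD(1) irr by blast
  show False
  proof (cases "c = c'")
    case True
    have "\<not> leaf rest x" "\<not> leaf rest y"
      using leaf_unique[of rest x y c] leaf_unique[of rest y x c] cx xy(1,2,3) True restD(2) vc
      by metis+
    then show False using nonleaf_unique[of c x y] c True cx xy' by blast
  next
    case False
    have E: "(c, x) \<in> E" "(y, c') \<in> E" "(x, y) \<in> E" "(c', v) \<in> E"
      using cx xy(1) vc restD symE by metis+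
    have d: "distinct [v, c, x, y, c']"
      using E vc False xy(2,3) irr restD(1,3)[OF xy(1)] restD(4)[OF xy(1)] bv
      by (auto simp: mem_clnb)
    show False
      using acyclic_graph_no_cyclic_list[OF G ac d] E vc by simp
  qed
qed

text \<open>
  Otherwise \<open>l\<close> and the leaf \<open>w\<close> can be taken in place of \<open>b\<close>. Their leaf edges are private to them,
  because neither \<open>b\<close> nor \<open>v\<close> is taken and no centre is adjacent to \<open>v\<close>, so the set is too large.
\<close>

lemma v_nbr_not_leaf:
  assumes w: "(v, w) \<in> E" "w \<noteq> b" shows "\<not> leaf E w"
proof
  assume lw: "leaf E w"
  let ?D = "insert l (insert w B)"
  have wv: "\<And>z. (w, z) \<in> E \<Longrightarrow> z = v" using lw w symE leaf_unique by metis
  have lb: "\<And>z. (l, z) \<in> E \<Longrightarrow> z = b" using leaf_l bl symE leaf_unique by metis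
  have vb: "v \<noteq> b" using bv irr by blast
  have vl: "v \<noteq> l" using w lb by blast
  have wout: "w \<notin> clnb E b" using wv[of b] w sym_iff vb by (auto simp: mem_clnb)
  have wF: "w \<notin> B" using v_nbr_not_centre w by blast
  have lin: "l \<in> clnb E b" using bl by (simp add: mem_clnb)
  have lB: "l \<notin> B" using B_outside lin by blast
  have bB: "b \<notin> B" using B_outside by (auto simp: mem_clnb)
  have lw': "l \<noteq> w" using wout lin by blast
  have ind: "indep E ?D"
    using indep_B wv lb irr v_notin_B bB vl w(2) symE unfolding indep_def 
    by (metis insert_iff)
  have D1: "?D \<inter> clnb E b = {l}" using lin wout B_outside by blast
  have D2: "?D \<inter> clnb E v = {w}"
  proof -
    have "l \<notin> clnb E v" using lb[of v] vl vb sym_iff by (auto simp: mem_clnb)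
    moreover have "c \<notin> clnb E v" if "c \<in> B" for c
      using that v_nbr_not_centre v_notin_B by (auto simp: mem_clnb)
    ultimately show ?thesis using w by (auto simp: mem_clnb)
  qed
  have "ve_dom E ?D"
  proof (rule ve_domI)
    fix x y assume "(x, y) \<in> E"
    then show "\<exists>d\<in>?D. d \<in> clnb E x \<or> d \<in> clnb E y"
    proof (cases rule: edge_cases)
      case 1
      then obtain c where "c \<in> B" "x \<in> clnb rest c" using class_ex[of x] by (auto simp: Field_def)
      then show ?thesis using rest_subset sym_iff by (auto simp: mem_clnb)
    qed (use bl w in \<open>auto simp: mem_clnb\<close>)
  qed
  moreover have "\<exists>e\<in>E. ?D \<inter> dominators E e = {d}" if d: "d \<in> ?D" for d
  proof -
    consider "d = l" | "d = w" | "d \<in> B" using d by blast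
    then show ?thesis
    proof cases
      case 1
      with D1 bl dominators_leaf_edge[OF G bl leaf_l] show ?thesis by metis
    next
      case 2
      with D2 w dominators_leaf_edge[OF G w(1) lw] show ?thesis by metis
    next
      case 3
      then obtain e where e: "e \<in> rest" "B \<inter> dominators rest e = {d}"
        using star_partition_centres[OF sgraph_rest P] by (auto simp: min_ve_dom_def)
      then have "B \<inter> dominators E e = {d}" using dominators_rest[OF B_Field] by simp
      moreover have "l \<notin> dominators E e" "w \<notin> dominators E e"
        using e(1) lb wv sym_iff bl bv lin wout by (cases e; auto simp: rest_def dominators_def mem_clnb)+
      ultimately show ?thesis using e(1) rest_subset by blast
    qed
  qed
  ultimately have "card ?D = Suc (card B)" using size ind by (simp add: min_ve_dom_def)
  then show False using finite_B lB wF lw' by simp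
qed


lemma leaf_l_nbr: "(l, z) \<in> E \<Longrightarrow> z = b"
  using leaf_l bl symE leaf_unique by metis

lemma l_not_dominator: "e \<in> rest \<Longrightarrow> l \<notin> dominators E e"
proof
  assume e: "e \<in> rest" "l \<in> dominators E e"
  obtain x y where xy: "e = (x, y)" by fastforce
  have "z \<in> clnb E b" if "l \<in> clnb E z" for z
    using that bl leaf_l_nbr symE unfolding mem_clnb by metis
  with e show False unfolding xy by (auto simp: dominators_def dest: restD)
qed

text \<open>
  The edge from a centre to one of its leaves in \<open>rest\<close> detects which members of a set lie in the
  class of that centre.
\<close>

lemma centre_private_edge:
  assumes "c \<in> B"
  obtains e where "e \<in> rest" "\<And>D. D \<subseteq> Field rest \<Longrightarrow> D \<inter> dominators E e = D \<inter> clnb rest c"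
proof -
  obtain m where m: "(c, m) \<in> rest" "leaf rest m"
    using P assms by (auto simp: star_partition_def)
  show thesis
    using that[OF m(1)] dominators_rest[OF _ m(1)] dominators_leaf_edge[OF sgraph_rest m] by simp
qed

lemma centre_in_clnb:
  assumes "c \<in> B" "x \<notin> clnb E b" "c \<in> clnb E x"
  shows "x \<in> clnb rest c"
proof (cases "c = x")
  case False
  then have "(c, x) \<in> E" using assms(3) symE by (auto simp: mem_clnb)
  then have "(c, x) \<in> rest" using assms(2) B_outside[OF assms(1)] by (simp add: rest_def)
  then show ?thesis by (simp add: mem_clnb)
qed (simp add: mem_clnb)

text \<open>
  If the class of \<open>c\<close> were only \<open>{c, w}\<close>, then \<open>v\<close>, being adjacent to \<open>w\<close>, would make \<open>c\<close>
  superfluous.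
\<close>

lemma v_nbr_class_not_pair:
  assumes w: "(v, w) \<in> E" and c: "c \<in> B" "(c, w) \<in> rest"
  shows "\<exists>z. (c, z) \<in> rest \<and> z \<noteq> w"
proof (rule ccontr)
  assume no: "\<nexists>z. (c, z) \<in> rest \<and> z \<noteq> w"
  obtain x y where xy: "(x, y) \<in> rest" "(v, x) \<notin> E" "(v, y) \<notin> E"
    and cl: "\<And>c'. c' \<in> B \<Longrightarrow> x \<in> clnb rest c' \<or> y \<in> clnb rest c' \<Longrightarrow> c' \<in> {c}"
  proof (rule not_dominated_by_v[of "{c}" c])
    show "{c} \<subseteq> B" "c \<in> {c}" using c by auto
    show "(v, c') \<notin> E" if "c' \<in> B - {c}" for c' using that v_nbr_not_centre by blast
  qed blast
  have only: "u = c" if u: "u = x \<or> u = y" for u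
  proof -
    have "u \<in> Field rest" using xy(1) u by (auto simp: Field_def)
    then obtain c' where c': "c' \<in> B" "u \<in> clnb rest c'" by (rule class_ex)
    then have "c' = c" using cl u by auto
    then show ?thesis using c' no w xy(2,3) u by (auto simp: mem_clnb)
  qed
  show False using only[of x] only[of y] xy(1) irr restD(1) by metis
qed

text \<open>
  Suppose that \<open>c\<close> has a neighbour \<open>w\<close> which is adjacent to \<open>v\<close> and otherwise a leaf, and also a
  non-leaf neighbour \<open>z\<close>. Let \<open>x \<noteq> c\<close> be a neighbour of \<open>z\<close>, in the class of \<open>c2\<close>, and \<open>l2\<close> a leaf
  at \<open>c2\<close>, so that the tree contains the path \<open>l, b, v, w, c, z, x, c2, l2\<close>. Its vertices \<open>b, c, c2\<close>
  can be replaced by \<open>l, w, z, l2\<close>. These four dominate the three classes, and they have the private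
  edges \<open>lb\<close>, \<open>vw\<close>, \<open>zx\<close> and a leaf edge at \<open>c2\<close>, which gives a set with one element too many.
\<close>

lemma v_nbr_leaf_class_all_leaves:
  assumes w: "(v, w) \<in> E" and c: "c \<in> B" "(c, w) \<in> rest" and lw: "leaf rest w"
    and z: "(c, z) \<in> rest" "z \<noteq> w"
  shows "leaf rest z"
proof (rule ccontr)
  assume nz: "\<not> leaf rest z"
  obtain x where x: "(z, x) \<in> rest" "x \<noteq> c"
    using not_leaf_other_nbr[OF nz] restD(2)[OF z(1)] by metis
  obtain c2 where c2: "c2 \<in> B" "x \<in> clnb rest c2" using class_ex[of x] x by (auto simp: Field_def)
  \<comment> \<open>Otherwise \<open>x\<close> and \<open>z\<close> would be two non-leaf neighbours of \<open>c\<close>.\<close>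
  have c2c: "c2 \<noteq> c"
  proof
    assume "c2 = c"
    then have cx: "(c, x) \<in> rest" using c2 x by (auto simp: mem_clnb)
    have "\<not> leaf rest x"
      using leaf_unique[of rest x c z] restD(2)[OF cx] restD(2)[OF x(1)] z restD(1) irr by metis
    then have "x = z" using nonleaf_unique c z nz cx by blast
    then show False using x(1) restD(1) irr by metis
  qed
  have zc: "z \<in> clnb rest c" using z by (simp add: mem_clnb)
  have z_class: "d = c" if "d \<in> B" "z \<in> clnb rest d" for d using class_unique that c zc by blast
  have x_class: "d = c2" if "d \<in> B" "x \<in> clnb rest d" for d using class_unique that c2 by blast
  have zc2: "z \<noteq> c2" using z_class[of c2] c2 c2c by (auto simp: mem_clnb)
  have "x \<noteq> c2" using z_class[of c2] c2 c2c restD(2)[OF x(1)] by (auto simp: mem_clnb)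
  then have c2x: "(c2, x) \<in> rest" using c2 by (auto simp: mem_clnb)
  have nx: "\<not> leaf rest x"
    using leaf_unique[of rest x z c2] restD(2)[OF x(1)] restD(2)[OF c2x] zc2 by metis
  obtain l2 where l2: "(c2, l2) \<in> rest" "leaf rest l2"
    using P c2(1) by (auto simp: star_partition_def)
  have l2x: "l2 \<noteq> x" using l2 nx by blast
  have l2c2: "l2 \<in> clnb rest c2" using l2 by (simp add: mem_clnb)
  have l2_class: "d = c2" if "d \<in> B" "l2 \<in> clnb rest d" for d
    using class_unique that c2 l2c2 by blast
  have wc: "w \<in> clnb rest c" using c by (simp add: mem_clnb)
  have w_class: "d = c" if "d \<in> B" "w \<in> clnb rest d" for d using class_unique that c wc by blast
  have out: "w \<notin> clnb E b" "z \<notin> clnb E b" "x \<notin> clnb E b" "l2 \<notin> clnb E b" "c2 \<notin> clnb E b"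
    "c \<notin> clnb E b"
    using restD(4) c(2) z(1) x(1) l2(1) B_outside c(1) c2(1) by blast+
  have vin: "v \<in> clnb E b" using bv by (simp add: mem_clnb)
  have lin: "l \<in> clnb E b" using bl by (simp add: mem_clnb)
  have wx: "w \<noteq> x" using lw nx by blast
  have zl2: "z \<noteq> l2" using nz l2 by blast
  have wl2: "w \<noteq> l2" using w_class[OF c2(1)] l2c2 c2c by blast
  have wc2: "w \<noteq> c2" using w_class[of c2] c2(1) c2c by (auto simp: mem_clnb)
  have cl2: "c \<noteq> l2" using l2_class[OF c(1)] c2c by (auto simp: mem_clnb)
  have E: "(w, c) \<in> E" "(c, z) \<in> E" "(z, c) \<in> E" "(z, x) \<in> E" "(x, c2) \<in> E" "(c2, l2) \<in> E"
    using c z x c2x l2 restD(1) symE by blast+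
  have vz: "(v, z) \<notin> E"
  proof
    assume "(v, z) \<in> E"
    moreover have "distinct [v, w, c, z]" using vin out z(2) E irr by auto
    ultimately show False
      using acyclic_graph_no_cyclic_list[OF G ac, of "[v, w, c, z]"] w E symE by auto
  qed
  \<comment> \<open>This and the previous step keep \<open>vw\<close> private to \<open>w\<close>.\<close>
  have vl2: "(v, l2) \<notin> E"
  proof
    assume "(v, l2) \<in> E"
    moreover have "distinct [v, w, c, z, x, c2, l2]"
      using vin out z(2) E irr wx wl2 wc2 x(2) c2c cl2 zc2 zl2 l2x
      by (simp; metis)
    ultimately show False
      using acyclic_graph_no_cyclic_list[OF G ac, of "[v, w, c, z, x, c2, l2]"] w E symE by auto
  qed
  have w_nbr: "y = c \<or> y = v" if "(w, y) \<in> E" for y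
    using outside_nbr[OF out(1) that] leaf_unique[OF lw] restD(2)[OF c(2)] by blast
  have l2_nbr: "y = c2" if "(l2, y) \<in> E" for y
    using outside_nbr[OF out(4) that] leaf_unique[OF l2(2)] restD(2)[OF l2(1)] that vl2 symE by blast
  have z_centre: "d = c" if "d \<in> B" "d \<in> clnb E z" for d
    using z_class centre_in_clnb that out by blast
  have x_centre: "d = c2" if "d \<in> B" "d \<in> clnb E x" for d
    using x_class centre_in_clnb that out by blast
  \<comment> \<open>The part \<open>?R\<close> of the new set lies in \<open>rest\<close>, where \<open>centre_private_edge\<close> applies.\<close>
  let ?R = "insert w (insert z (insert l2 (B - {c, c2})))"
  let ?D = "insert l ?R"
  have RF: "?R \<subseteq> Field rest"
    using B_Field c z l2 by (auto simp: Field_def)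
  have notB: "w \<notin> B" "z \<notin> B" "l2 \<notin> B" "l \<notin> B"
    using v_nbr_not_centre[OF w] z_class[of z] zc c z l2_class[of l2] l2 restD(1) irr B_outside lin
    by (metis mem_clnb)+
  have lR: "l \<notin> ?R" using rest_Field RF lin by blast
  have "ve_dom E ?D"
  proof (rule ve_domI)
    fix p q assume "(p, q) \<in> E"
    then show "\<exists>d\<in>?D. d \<in> clnb E p \<or> d \<in> clnb E q"
    proof (cases rule: edge_cases)
      case 1
      then obtain c' where c': "c' \<in> B" "p \<in> clnb rest c'"
        using class_ex[of p] by (auto simp: Field_def)
      have leaf_nbr: "p = c' \<or> q = c' \<or> (c', p) \<in> rest \<and> \<not> leaf rest p"
        using c'(2) leaf_unique[of rest p q c'] 1 restD(2) by (auto simp: mem_clnb)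
      consider "c' = c" | "c' = c2" | "c' \<in> ?D" using c' by blast
      then show ?thesis
      proof cases
        case 1
        then have "w \<in> clnb E p \<or> w \<in> clnb E q \<or> z \<in> clnb E p"
          using leaf_nbr nonleaf_unique[of c p z] c z nz E(1) symE unfolding mem_clnb by metis
        then show ?thesis by blast
      next
        case 2
        then have "l2 \<in> clnb E p \<or> l2 \<in> clnb E q \<or> z \<in> clnb E p"
          using leaf_nbr nonleaf_unique[of c2 p x] c2(1) c2x nx E symE unfolding mem_clnb by metis
        then show ?thesis by blast
      next
        case 3
        have "c' \<in> clnb E p" using c'(2) restD(1) symE unfolding mem_clnb by metis
        with 3 show ?thesis by blast
      qed
    next
      case 2 then show ?thesis using bl by (auto simp: mem_clnb)
    next
      case 3 then show ?thesis using bl by (auto simp: mem_clnb)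
    next
      case 4 then show ?thesis using w by (auto simp: mem_clnb)
    next
      case 5 then show ?thesis using w by (auto simp: mem_clnb)
    qed
  qed
  moreover have "\<exists>e\<in>E. ?D \<inter> dominators E e = {d}" if d: "d \<in> ?D" for d
  proof -
    consider "d = l" | "d = w" | "d = z" | "d = l2" | "d \<in> B - {c, c2}" using d by blast
    then show ?thesis
    proof cases
      case 1
      have "?D \<inter> clnb E b = {l}" using lin RF rest_Field by blast
      then have "?D \<inter> dominators E (b, l) = {d}"
        by (simp only: 1 dominators_leaf_edge[OF G bl leaf_l])
      then show ?thesis using bl by blast
    next
      case 2
      have wd: "u = w" if "u \<in> ?D" "u \<in> clnb E v \<or> u \<in> clnb E w" for u
      proof (rule ccontr)
        assume uw: "u \<noteq> w"
        have "w \<noteq> b" using out by (auto simp: mem_clnb)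
        then have "l \<noteq> v" "(v, l) \<notin> E" "(w, l) \<notin> E"
          using leaf_l_nbr w symE bv irr out(1) unfolding mem_clnb by metis+
        moreover have "c \<noteq> z" using E irr by blast
        moreover have "(v, u) \<notin> E" if "u \<in> B" using v_nbr_not_centre that by blast
        ultimately show False
          using that uw w_nbr[of u] vz vl2 cl2 v_notin_B vin out lin unfolding mem_clnb by blast
      qed
      show ?thesis unfolding 2 by (rule private_edgeI[OF w _ _ wd]) (simp_all add: mem_clnb)
    next
      case 3
      have zd: "u = z" if "u \<in> ?D" "u \<in> clnb E z \<or> u \<in> clnb E x" for u
      proof -
        have "u \<noteq> l" using l_not_dominator[OF x(1)] that(2) by (auto simp: dominators_def)
        moreover have "w \<notin> clnb E z" "w \<notin> clnb E x"
          using w_nbr[of z] w_nbr[of x] symE z(2) wx x(2) out vin E(2) irr unfolding mem_clnb by metis+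
        moreover have "l2 \<notin> clnb E z" "l2 \<notin> clnb E x"
          using l2_nbr[of z] l2_nbr[of x] symE zl2 l2x zc2 \<open>x \<noteq> c2\<close> unfolding mem_clnb by metis+
        ultimately show ?thesis using that z_centre[of u] x_centre[of u] by blast
      qed
      show ?thesis unfolding 3 by (rule private_edgeI[OF E(4) _ _ zd]) (simp_all add: mem_clnb)
    next
      case 4
      obtain e where e: "e \<in> rest" "?R \<inter> dominators E e = ?R \<inter> clnb rest c2"
        using centre_private_edge[OF c2(1)] RF by metis
      have "u = l2" if "u \<in> ?R" "u \<in> clnb rest c2" for u
        using that w_class[of c2] z_class[of c2] c2c c2(1) class_unique[of u c2 u]
        by (auto simp: mem_clnb)
      then have "?R \<inter> clnb rest c2 = {l2}" using l2c2 by blast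
      then have "?D \<inter> dominators E e = {d}" using e l_not_dominator[OF e(1)] 4 by (metis Int_insert_left)
      then show ?thesis using e(1) rest_subset by (metis subsetD)
    next
      case 5
      then have dB: "d \<in> B" by blast
      obtain e where e: "e \<in> rest" "?R \<inter> dominators E e = ?R \<inter> clnb rest d"
        using centre_private_edge[OF dB] RF by metis
      have "u = d" if "u \<in> ?R" "u \<in> clnb rest d" for u
        using that w_class[of d] z_class[of d] l2_class[of d] 5 class_unique[of u d u]
        by (auto simp: mem_clnb)
      moreover have "d \<in> ?R \<inter> clnb rest d" using 5 by (simp add: mem_clnb)
      ultimately have "?R \<inter> clnb rest d = {d}" by blast
      then have "?D \<inter> dominators E e = {d}" using e l_not_dominator[OF e(1)] by (metis Int_insert_left)
      then show ?thesis using e(1) rest_subset by (metis subsetD)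
    qed
  qed
  moreover have "indep E ?D"
  proof -
    have "(l, u) \<notin> E" if "u \<in> ?D" for u
      using leaf_l_nbr[of u] that irr RF rest_Field[of b] by (auto simp: mem_clnb)
    moreover have "(w, u) \<notin> E" if "u \<in> ?R" for u
      using w_nbr[of u] that RF rest_Field[of v] vin z(2) cl2 E(2) irr v_notin_B out c(1) notB by blast
    moreover have "(z, u) \<notin> E" if "u \<in> B - {c, c2}" for u
      using z_centre[of u] that by (auto simp: mem_clnb)
    moreover have "(l2, u) \<notin> E" if "u \<in> insert z (insert l2 (B - {c, c2}))" for u
      using l2_nbr[of u] that zc2 notB(3) c2(1) by blast
    moreover have "(z, l2) \<notin> E" using l2_nbr[of z] zc2 symE by blast
    moreover have "indep E (B - {c, c2})" using indep_B by (simp add: indep_def)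
    ultimately show ?thesis by (intro indep_insertI[OF G]) auto
  qed
  ultimately have "card ?D = Suc (card B)" using size by (simp add: min_ve_dom_def)
  moreover have "card ?D = card (B - {c, c2}) + 4"
    using finite_B lR notB wl2 z(2) zl2 by auto
  moreover have "card (B - {c, c2}) = card B - 2" "2 \<le> card B"
    using finite_B c(1) c2(1) c2c card_mono[of B "{c, c2}"] by (auto simp: card_Diff_subset)
  ultimately show False by simp
qed

lemma no_two_v_nbrs_in_class:
  assumes "c \<in> B" "(c, x) \<in> rest" "(c, y) \<in> rest" "(v, x) \<in> E" "(v, y) \<in> E"
  shows "x = y"
proof (rule ccontr)
  assume "x \<noteq> y"
  have vin: "v \<in> clnb E b" using bv by (simp add: mem_clnb)
  have "distinct [v, x, c, y]"
    using \<open>x \<noteq> y\<close> vin restD(1,3,4)[OF assms(2)] restD(1,4)[OF assms(3)] irr by auto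
  moreover have "(x, c) \<in> E" "(c, y) \<in> E" "(y, v) \<in> E"
    using assms restD(1) symE by blast+
  ultimately show False
    using acyclic_graph_no_cyclic_list[OF G ac, of "[v, x, c, y]"] assms(4) by simp
qed

text \<open>Leaves of \<open>rest\<close> can only stop being leaves through an edge to \<open>v\<close>.\<close>

lemma leaf_rest_imp_leaf:
  assumes "leaf rest x" "(x, y) \<in> rest" "(v, x) \<notin> E"
  shows "leaf E x"
proof (rule leafI)
  show "(x, y) \<in> E" using assms restD(1) by blast
  show "z = y" if "(x, z) \<in> E" for z
    using outside_nbr[OF restD(3)[OF assms(2)] that] leaf_unique assms that symE by metis
qed

text \<open>
  Since \<open>v\<close> is not adjacent to centres, the classes remain closed neighbourhoods in \<open>E\<close>. If a leaf
  \<open>m\<close> at \<open>c\<close> becomes a non-leaf through an edge to \<open>v\<close>, then all other neighbours of \<open>c\<close> are leaves,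
  at least one exists, and by acyclicity none of them is adjacent to \<open>v\<close>; so \<open>c\<close> still has a leaf and
  \<open>m\<close> is its only non-leaf neighbour. Neighbours of \<open>v\<close> outside \<open>N[b]\<close> are covered because they
  are not leaves.
\<close>

lemma star_partition_insert: "star_partition E (insert b B)"
proof -
  have centre_nbr: "(c, y) \<in> rest" if "c \<in> B" "(c, y) \<in> E" for c y
    using outside_nbr[OF B_outside] that v_nbr_not_centre symE by blast
  have clnb_eq: "clnb E c = clnb rest c" if "c \<in> B" for c
    using centre_nbr[OF that] rest_subset by (auto simp: clnb_def)
  have clnb_out: "clnb rest c \<inter> clnb E b = {}" if "c \<in> B" for c
    using B_outside[OF that] restD(4) by (auto simp: clnb_def)
  have "\<exists>l. (c, l) \<in> E \<and> leaf E l" if c: "c \<in> B" for c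
  proof -
    obtain m where m: "(c, m) \<in> rest" "leaf rest m" using P c by (auto simp: star_partition_def)
    show ?thesis
    proof (cases "(v, m) \<in> E")
      case True
      obtain z where z: "(c, z) \<in> rest" "z \<noteq> m"
        using v_nbr_class_not_pair True c m by blast
      then have "leaf rest z" using v_nbr_leaf_class_all_leaves True c m by blast
      moreover have "(v, z) \<notin> E" using no_two_v_nbrs_in_class c m z True by blast
      ultimately have "leaf E z" using leaf_rest_imp_leaf z restD(2) by blast
      then show ?thesis using z rest_subset by blast
    next
      case False
      then have "leaf E m" using leaf_rest_imp_leaf m restD(2) by blast
      then show ?thesis using m rest_subset by blast
    qed
  qed
  moreover have "x = y"
    if c: "c \<in> B" and xy: "(c, x) \<in> E" "(c, y) \<in> E" "\<not> leaf E x" "\<not> leaf E y" for c x y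
  proof (rule ccontr)
    assume ne: "x \<noteq> y"
    have r: "(c, x) \<in> rest" "(c, y) \<in> rest" using centre_nbr c xy by blast+
    have v: "(v, u) \<in> E" if "leaf rest u" "(c, u) \<in> rest" "\<not> leaf E u" for u
      using leaf_rest_imp_leaf that restD(2) by blast
    have "leaf rest x \<or> leaf rest y" using nonleaf_unique[OF c r] ne by blast
    then have "leaf rest x" "leaf rest y"
      using v_nbr_leaf_class_all_leaves[OF _ c] v r xy ne by metis+
    then show False using no_two_v_nbrs_in_class[OF c r] v r xy ne by blast
  qed
  moreover have "Field E \<subseteq> (\<Union>c\<in>insert b B. clnb E c)"
  proof
    fix x assume "x \<in> Field E"
    then obtain y where y: "(x, y) \<in> E" using symE by (auto simp: Field_def)
    show "x \<in> (\<Union>c\<in>insert b B. clnb E c)"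
    proof (cases "x \<in> clnb E b")
      case False
      have "x \<in> Field rest"
      proof (rule ccontr)
        assume "x \<notin> Field rest"
        then have nbr: "\<And>z. (x, z) \<in> E \<Longrightarrow> z = v"
          using outside_nbr[OF False] by (auto simp: Field_def)
        then have "(x, v) \<in> E" "leaf E x" using y leafI by metis+
        moreover have "x \<noteq> b" using False by (auto simp: mem_clnb)
        ultimately show False using v_nbr_not_leaf symE by blast
      qed
      then obtain c where "c \<in> B" "x \<in> clnb rest c" using class_ex by blast
      then show ?thesis using clnb_eq by blast
    qed blast
  qed
  moreover have "clnb E c \<inter> clnb E d = {}" if cd: "c \<in> insert b B" "d \<in> insert b B" "c \<noteq> d" for c d
  proof -
    have "clnb E c \<inter> clnb E d = {}" if "c \<in> B" "d \<in> B"
      using class_unique[OF that] cd(3) clnb_eq that by blast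
    then show ?thesis using cd clnb_out clnb_eq by blast
  qed
  moreover have "x = y"
    if "(b, x) \<in> E" "(b, y) \<in> E" "\<not> leaf E x" "\<not> leaf E y" for x y
    using others that by blast
  ultimately show ?thesis
    unfolding star_partition_def using bl leaf_l by (intro conjI ballI allI impI; (elim insertE)?; blast)
qed

end

section \<open>Well-covered forests\<close>

text \<open>
  In the subgraph induced by the non-leaves, some vertex \<open>b\<close> has degree at most one. It has at least
  two neighbours in all, so one of them is a leaf. If there are no non-leaves, any edge will do.
\<close>

lemma end_star_exists:
  assumes G: "sgraph E" and ac: "acyclic_graph E" and "E \<noteq> {}"
  shows "\<exists>b l v. end_star E b l v"
proof -
  let ?S = "{x \<in> Field E. \<not> leaf E x}"
  obtain b0 v0 where bv0: "(b0, v0) \<in> E" using \<open>E \<noteq> {}\<close> by auto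
  have F: "x \<in> Field E" "y \<in> Field E" if "(x, y) \<in> E" for x y
    using that by (auto simp: Field_def)
  show ?thesis
  proof (cases "?S = {}")
    case True
    have "end_star E b0 v0 v0"
      using G ac bv0 True F by unfold_locales auto
    then show ?thesis by blast
  next
    case False
    have fin: "finite ?S"
      using G finite_Field[of E] by (intro finite_subset[of ?S "Field E"]) (auto simp: sgraph_def)
    have "\<exists>b\<in>?S. \<forall>x\<in>?S. \<forall>y\<in>?S. (b, x) \<in> E \<longrightarrow> (b, y) \<in> E \<longrightarrow> x = y"
      by (rule mp[OF mp[OF spec[OF ac[unfolded acyclic_graph_def]] fin] False])
    then obtain b where b: "b \<in> ?S"
      and uniq: "\<And>x y. x \<in> ?S \<Longrightarrow> y \<in> ?S \<Longrightarrow> (b, x) \<in> E \<Longrightarrow> (b, y) \<in> E \<Longrightarrow> x = y"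
      by blast
    obtain y where y: "(b, y) \<in> E" using b sgraph_sym[OF G] by (auto simp: Field_def)
    obtain z where z: "(b, z) \<in> E" "z \<noteq> y" using not_leaf_other_nbr[of E b y] b y by blast
    have "leaf E y \<or> leaf E z" using uniq[of y z] y z F by blast
    then obtain l where l: "(b, l) \<in> E" "leaf E l" using y z by blast
    obtain v where v: "(b, v) \<in> E" "\<And>x. (b, x) \<in> E \<Longrightarrow> x \<noteq> v \<Longrightarrow> leaf E x"
      using l uniq F by (metis (mono_tags, lifting) mem_Collect_eq)
    have "end_star E b l v" using G ac l v by unfold_locales auto
    then show ?thesis by blast
  qed
qed

theorem well_covered_forest_star_partition:
  assumes "sgraph E" "acyclic_graph E"
    and "\<And>D D'. min_ve_dom E D \<Longrightarrow> indep E D \<Longrightarrow> min_ve_dom E D' \<Longrightarrow> indep E D' \<Longrightarrow> card D = card D'"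
  shows "\<exists>B. star_partition E B"
  using assms
proof (induction "card E" arbitrary: E rule: less_induct)
  case less
  show ?case
  proof (cases "E = {}")
    case True
    then have "star_partition E {}" by (simp add: star_partition_def)
    then show ?thesis by blast
  next
    case False
    then obtain b l v where "end_star E b l v" using end_star_exists less.prems by blast
    then interpret end_star E b l v .
    have finE: "finite E" using G by (simp add: sgraph_def)
    have "(b, l) \<notin> rest" by (auto simp: rest_def mem_clnb)
    then have "card rest < card E" using bl rest_subset finE by (intro psubset_card_mono) auto
    moreover have fin: "finite D" if "min_ve_dom rest D" for D
      using min_ve_dom_subset_Field[OF that] sgraph_rest finite_Field finite_subset
      unfolding sgraph_def by metis
    have "card D = card D'"
      if D: "min_ve_dom rest D" "indep rest D" "min_ve_dom rest D'" "indep rest D'" for D D'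
    proof -
      have "card (insert b D) = card (insert b D')"
        using less.prems(3) min_ve_dom_insert_centre D by blast
      then show ?thesis using fin min_ve_dom_insert_centre(3) D by simp
    qed
    ultimately obtain B where B: "star_partition rest B"
      using less.hyps[of rest] sgraph_rest acyclic_graph_subset[OF ac rest_subset] by blast
    note centres = star_partition_centres[OF sgraph_rest B]
    have "card D = Suc (card B)" if "min_ve_dom E D" "indep E D" for D
      using less.prems(3)[OF that] min_ve_dom_insert_centre[OF centres] fin[OF centres(1)] by simp
    with B interpret end_star_covered E b l v B by unfold_locales
    show ?thesis using star_partition_insert by blast
  qed
qed

section \<open>Trees\<close>

text \<open>
  If all vertices of \<open>S\<close> had two neighbours in \<open>S\<close>, consider a longest path in \<open>S\<close>. By maximality both
  neighbours of its first vertex lie on it, and the one that is not the second vertex closes a cycle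
  of length at least three.
\<close>

lemma undirected_tree_acyclic_graph:
  assumes "undirected_tree T" shows "acyclic_graph (parcs T)"
proof (rule ccontr)
  assume "\<not> acyclic_graph (parcs T)"
  interpret pair_graph T using assms by (simp add: undirected_tree_def)
  obtain S where S: "finite S" "S \<noteq> {}"
    and deg: "\<And>s. s \<in> S \<Longrightarrow> \<exists>x\<in>S. \<exists>y\<in>S. (s, x) \<in> parcs T \<and> (s, y) \<in> parcs T \<and> x \<noteq> y"
    using \<open>\<not> acyclic_graph (parcs T)\<close> unfolding acyclic_graph_def by metis
  have sym: "(y, x) \<in> parcs T" if "(x, y) \<in> parcs T" for x y
    using that pair_sym_arcs by (auto simp: symmetric_conv)
  have loop: "(x, x) \<notin> parcs T" for x using pair_no_loops by fastforce
  define path where "path p \<longleftrightarrow> (\<exists>u w. apath u p w \<and> set (awalk_verts u p) \<subseteq> S)" for p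
  obtain s0 where s0: "s0 \<in> S" using S by blast
  then have "s0 \<in> pverts T" using deg wellformed by fastforce
  then have "path []" using s0 by (auto simp: path_def apath_Nil_iff)
  moreover have "length p < card S" if "path p" for p
  proof -
    obtain u w where p: "apath u p w" "set (awalk_verts u p) \<subseteq> S" using \<open>path p\<close> unfolding path_def by blast
    then have "card (set (awalk_verts u p)) \<le> card S" using S card_mono by blast
    moreover have "card (set (awalk_verts u p)) = Suc (length p)"
      using p by (simp add: apath_def distinct_card length_awalk_verts)
    ultimately show ?thesis by simp
  qed
  ultimately obtain p where p: "path p" "\<And>q. path q \<Longrightarrow> length q \<le> length p"
    using ex_has_greatest_nat[of path "[]" length "card S"] by (metis less_imp_le)
  then obtain u w where uw: "apath u p w" "set (awalk_verts u p) \<subseteq> S" unfolding path_def by blast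
  then have aw: "awalk u p w" and dist: "distinct (awalk_verts u p)" by (auto simp: apath_def)
  have uS: "u \<in> S" using uw hd_in_awalk_verts by blast
  have on_path: "x \<in> set (awalk_verts u p)" if x: "x \<in> S" "(u, x) \<in> parcs T" for x
  proof (rule ccontr)
    assume nx: "x \<notin> set (awalk_verts u p)"
    have "apath x ((x, u) # p) w"
      using uw(1) nx sym[OF x(2)] by (simp add: apath_Cons_iff)
    moreover have "set (awalk_verts x ((x, u) # p)) \<subseteq> S" using uw x by simp
    ultimately have "path ((x, u) # p)" unfolding path_def by blast
    then show False using p(2) by fastforce
  qed
  obtain y where y: "y \<in> S" "(u, y) \<in> parcs T" "p = [] \<or> y \<noteq> snd (hd p)"
    using deg[OF uS] by metis
  obtain q r where q: "p = q @ r" "awalk u q y"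
    using awalk_decomp[OF aw on_path[OF y(1,2)]] by blast
  have "2 \<le> length q"
  proof (rule ccontr)
    assume "\<not> 2 \<le> length q"
    then consider "q = []" | e where "q = [e]" by (cases q) (auto simp: Suc_le_eq)
    then show False
    proof cases
      case 1 then show ?thesis using q(2) y(2) loop by (auto simp: awalk_Nil_iff)
    next
      case 2 then show ?thesis using q y(3) by (auto simp: awalk_Cons_iff awalk_Nil_iff)
    qed
  qed
  moreover have "cycle ((y, u) # q)"
  proof -
    have "awalk y ((y, u) # q) y" using q(2) sym[OF y(2)] by (simp add: awalk_Cons_iff)
    moreover have "distinct (awalk_verts u q)"
      using dist awalk_verts_append[of u q r w] aw q(1) by simp
    ultimately show ?thesis by (auto simp: cycle_def)
  qed
  ultimately show False using assms by (fastforce simp: undirected_tree_def)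
qed

theorem corollary19:
  fixes T :: "'a pair_pre_digraph"
  assumes "undirected_tree T"
    and "2 \<le> card (pverts T)"
  shows "well_ve_covered T \<longleftrightarrow> well_ve_dominated T"
proof
  assume "well_ve_dominated T"
  then show "well_ve_covered T" by (auto simp: well_ve_dominated_def well_ve_covered_def)
next
  assume wc: "well_ve_covered T"
  interpret pair_graph T using assms(1) by (simp add: undirected_tree_def)
  let ?E = "parcs T"
  have sg: "sgraph ?E"
    using pair_finite_arcs pair_sym_arcs pair_no_loops
    by (fastforce simp: sgraph_def irrefl_def symmetric_def)
  have F: "Field ?E \<subseteq> pverts T"
    using arc_fst_in_verts arc_snd_in_verts by (force simp: Field_def)
  have nbhd: "closed_nbhd T x = clnb ?E x" for x
    using F by (auto simp: closed_nbhd_def clnb_def Field_def)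
  have dom: "ve_dominates T d e \<longleftrightarrow> d \<in> dominators ?E e" for d e
    using sgraph_sym_iff[OF sg]
    by (auto simp: ve_dominates_def dominators_def nbhd mem_clnb)
  have ds: "ve_dominating_set T D \<longleftrightarrow> D \<subseteq> pverts T \<and> ve_dom ?E D" for D
    by (auto simp: ve_dominating_set_def dom ve_dom_def)
  have min: "minimal_ve_dominating_set T D \<longleftrightarrow> min_ve_dom ?E D" for D
    using min_ve_dom_subset_Field[of ?E D] F
    unfolding minimal_ve_dominating_set_def ds min_ve_dom_iff_minimal by blast
  have ind: "independent_set T D \<longleftrightarrow> D \<subseteq> pverts T \<and> indep ?E D" for D
    by (auto simp: independent_set_def indep_def)
  have "card D = card D'"
    if "min_ve_dom ?E D" "indep ?E D" "min_ve_dom ?E D'" "indep ?E D'" for D D'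
    using wc that min_ve_dom_subset_Field F unfolding well_ve_covered_def min ind by blast
  then obtain B where "star_partition ?E B"
    using well_covered_forest_star_partition[OF sg undirected_tree_acyclic_graph[OF assms(1)]]
    by blast
  then show "well_ve_dominated T"
    using star_partition_card[OF sg] by (simp add: well_ve_dominated_def min)
qed

end
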